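(* Let $c_n$ be the number of separable permutations $\sigma=\sigma_1\cdots\sigma_n$ of length $n$ having exactly two indices $i$ with $|\sigma_i-\sigma_{i+1}|=1$ or $|\sigma_{i-1}-\sigma_i|=1$ (ignoring nonexistent entries). Then $c_0=c_1=0$, $c_2=2$, and $c_n=2c_{n-1}+c_{n-2}$ for $n\ge3$. Consequently $$\sum_{n\ge0}c_nt^n=\frac{2t^2}{1-2t-t^2}.$$
   Context: A permutation is separable if it avoids both patterns $2413$ and $3142$, i.e., it has no subsequence of four entries order-isomorphic to $2413$ or to $3142$. *)

theory Defs
  imports
    "HOL-Combinatorics.Multiset_Permutations"
    "HOL-Library.Sublist"
    "HOL-Computational_Algebra.Formal_Power_Series"
begin

text \<open>
  A permutation of length \<open>n\<close> is given in one-line notation, as a list in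
  \<^term>\<open>permutations_of_set {1..n}\<close>.
\<close>

definition order_isomorphic :: "nat list \<Rightarrow> nat list \<Rightarrow> bool" where
  "order_isomorphic xs ys \<longleftrightarrow>
     length xs = length ys \<and>
     (\<forall>i<length xs. \<forall>j<length xs. xs ! i < xs ! j \<longleftrightarrow> ys ! i < ys ! j)"

definition contains_pattern :: "nat list \<Rightarrow> nat list \<Rightarrow> bool" where
  "contains_pattern p s \<longleftrightarrow> (\<exists>t. subseq t s \<and> order_isomorphic t p)"

definition separable :: "nat list \<Rightarrow> bool" where
  "separable s \<longleftrightarrow> \<not> contains_pattern [2, 4, 1, 3] s \<and> \<not> contains_pattern [3, 1, 4, 2] s"

text \<open>
  List positions start at 0, so position \<open>i\<close> holds the entry with index \<open>i + 1\<close>;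
  this shift does not affect the number of indices. Entries are coerced to
  integers because subtraction of natural numbers truncates.
\<close>

definition bonded_positions :: "nat list \<Rightarrow> nat set" where
  "bonded_positions s =
     {i. i < length s \<and>
         ((i + 1 < length s \<and> \<bar>int (s ! i) - int (s ! (i + 1))\<bar> = 1) \<or>
          (1 \<le> i \<and> \<bar>int (s ! (i - 1)) - int (s ! i)\<bar> = 1))}"

definition c :: "nat \<Rightarrow> nat" where
  "c n = card {s \<in> permutations_of_set {1..n}. separable s \<and> card (bonded_positions s) = 2}"

end

theory Submission imports Defs begin

text \<open>
  Exactly two bonded positions means exactly one bond, i.e. one pair of adjacent entries with
  consecutive values. A separable permutation of length at least two is a direct or a skew sum
  of shorter ones, and by induction it has a bond. Up to reversal, a permutation with exactly
  one bond is a direct sum; since every summand of length at least two contributes a bond, for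
  length at least three it is \<open>1 \<oplus> \<alpha>\<close>, \<open>\<alpha> \<oplus> 1\<close> or \<open>1 \<oplus> \<alpha> \<oplus> 1\<close> with \<open>\<alpha>\<close> a skew sum
  with exactly one bond. Comparing the first with the last entry tells direct from skew sums.
\<close>

section \<open>Direct and skew splittings, and pattern avoidance\<close>

text \<open>With \<open>R\<close> equal to \<open><\<close> this describes a direct sum, with
  \<open>>\<close> a skew sum. The values need not form an interval, so the notion applies to
  subsequences without renumbering them.\<close>

definition splits :: "('a \<Rightarrow> 'a \<Rightarrow> bool) \<Rightarrow> 'a list \<Rightarrow> bool" where
  "splits R xs \<longleftrightarrow>
     (\<exists>as bs. xs = as @ bs \<and> as \<noteq> [] \<and> bs \<noteq> [] \<and> (\<forall>a\<in>set as. \<forall>b\<in>set bs. R a b))"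

lemma splits_hd_last: "splits R xs \<Longrightarrow> R (hd xs) (last xs)"
  by (auto simp: splits_def)

lemma contains_pattern_2413:
  "contains_pattern [2, 4, 1, 3] s \<longleftrightarrow> (\<exists>w x y z. subseq [w, x, y, z] s \<and> y < w \<and> w < z \<and> z < x)"
proof -
  have "length t = 4 \<longleftrightarrow> (\<exists>w x y z. t = [w, x, y, z])" for t :: "nat list"
    by (auto simp: numeral_eq_Suc length_Suc_conv)
  moreover have "order_isomorphic [w, x, y, z] [2, 4, 1, 3] \<longleftrightarrow> y < w \<and> w < z \<and> z < x" for w x y z
    by (auto simp: order_isomorphic_def numeral_eq_Suc All_less_Suc2)
  moreover have "order_isomorphic t [2, 4, 1, 3] \<Longrightarrow> length t = 4" for t
    by (simp add: order_isomorphic_def)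
  ultimately show ?thesis
    unfolding contains_pattern_def by metis
qed

lemma contains_pattern_3142:
  "contains_pattern [3, 1, 4, 2] s \<longleftrightarrow> (\<exists>w x y z. subseq [w, x, y, z] s \<and> x < z \<and> z < w \<and> w < y)"
proof -
  have "length t = 4 \<longleftrightarrow> (\<exists>w x y z. t = [w, x, y, z])" for t :: "nat list"
    by (auto simp: numeral_eq_Suc length_Suc_conv)
  moreover have "order_isomorphic [w, x, y, z] [3, 1, 4, 2] \<longleftrightarrow> x < z \<and> z < w \<and> w < y" for w x y z
    by (auto simp: order_isomorphic_def numeral_eq_Suc All_less_Suc2)
  moreover have "order_isomorphic t [3, 1, 4, 2] \<Longrightarrow> length t = 4" for t
    by (simp add: order_isomorphic_def)
  ultimately show ?thesis
    unfolding contains_pattern_def by metis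
qed

lemma separable_iff:
  "separable s \<longleftrightarrow> (\<forall>w x y z. subseq [w, x, y, z] s \<longrightarrow>
     \<not> (y < w \<and> w < z \<and> z < x) \<and> \<not> (x < z \<and> z < w \<and> w < y))"
  unfolding separable_def contains_pattern_2413 contains_pattern_3142 by blast

lemma separable_subseq: "separable s \<Longrightarrow> subseq t s \<Longrightarrow> separable t"
  unfolding separable_def contains_pattern_def by (meson subseq_order.trans)

lemma subseq_imp_subseq_rev: "subseq xs ys \<Longrightarrow> subseq (rev xs) (rev ys)"
  by (induction rule: list_emb.induct) (auto intro: list_emb_append_mono)

text \<open>Reversal exchanges the two patterns 2413 and 3142.\<close>

lemma separable_rev [simp]: "separable (rev s) \<longleftrightarrow> separable s"
proof -
  have "separable (rev s)" if "separable s" for s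
    unfolding separable_iff
  proof (intro allI impI)
    fix w x y z assume "subseq [w, x, y, z] (rev s)"
    hence "subseq [z, y, x, w] s"
      using subseq_imp_subseq_rev by fastforce
    with that show "\<not> (y < w \<and> w < z \<and> z < x) \<and> \<not> (x < z \<and> z < w \<and> w < y)"
      unfolding separable_iff by blast
  qed
  from this[of s] this[of "rev s"] show ?thesis by auto
qed

text \<open>Both forbidden patterns begin with a middle value, so an entry that is smaller or larger
  than all later ones cannot start an occurrence.\<close>

lemma separable_Cons:
  assumes "separable s" "(\<forall>y\<in>set s. x < y) \<or> (\<forall>y\<in>set s. y < x)"
  shows "separable (x # s)"
  unfolding separable_iff
proof (intro allI impI)
  fix p q r t assume sub: "subseq [p, q, r, t] (x # s)"
  show "\<not> (r < p \<and> p < t \<and> t < q) \<and> \<not> (q < t \<and> t < p \<and> p < r)"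
  proof (cases "p = x")
    case True
    with sub have "subseq [q, r, t] s" by simp
    hence "set [q, r, t] \<subseteq> set s" by (metis notin_set_nthsI subseq_conv_nths subsetI)
    with True assms(2) show ?thesis by fastforce
  next
    case False
    with sub have "subseq [p, q, r, t] s" by simp
    with assms(1) show ?thesis unfolding separable_iff by blast
  qed
qed

lemma separable_snoc:
  assumes "separable s" "\<forall>y\<in>set s. y < x"
  shows "separable (s @ [x])"
proof -
  have "separable (x # rev s)" using assms by (intro separable_Cons) auto
  thus ?thesis using separable_rev[of "s @ [x]"] by simp
qed

section \<open>Every separable sequence of length at least two splits\<close>

text \<open>The relation is left abstract so that the step can be used for \<open><\<close> and for \<open>>\<close>. The
  shortest prefix \<open>as\<close> at which \<open>ys\<close> splits along \<open>R\<close> does not itself split along \<open>R\<close>; hence a last entry \<open>x\<close> lying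
  strictly inside the range of \<open>as\<close> splits \<open>as @ [x]\<close> along the converse of \<open>R\<close> and so
  completes a forbidden pattern with any entry after \<open>as\<close>.\<close>

lemma splits_snoc:
  fixes R :: "'a \<Rightarrow> 'a \<Rightarrow> bool"
  assumes trans: "\<And>x y z. R x y \<Longrightarrow> R y z \<Longrightarrow> R x z"
    and total: "\<And>x y. x \<noteq> y \<Longrightarrow> R x y \<or> R y x"
    and irrefl: "\<And>x. \<not> R x x"
    and avoid: "\<And>p q r t. subseq [p, q, r, t] (ys @ [x]) \<Longrightarrow> \<not> (R q t \<and> R t p \<and> R p r)"
    and IH: "\<And>zs. subseq zs (ys @ [x]) \<Longrightarrow> length zs \<le> length ys \<Longrightarrow> 2 \<le> length zs \<Longrightarrow>
               splits R zs \<or> splits R\<inverse>\<inverse> zs"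
    and dist: "distinct (ys @ [x])"
    and "splits R ys"
  shows "splits R (ys @ [x]) \<or> splits R\<inverse>\<inverse> (ys @ [x])"
proof -
  have asym: "\<not> R v u" if "R u v" for u v using trans[OF that, of u] irrefl by blast
  define good where "good as \<longleftrightarrow> (\<exists>bs. ys = as @ bs \<and> as \<noteq> [] \<and> bs \<noteq> [] \<and>
    (\<forall>a\<in>set as. \<forall>b\<in>set bs. R a b))" for as
  have "\<exists>as. good as" using \<open>splits R ys\<close> by (auto simp: splits_def good_def)
  then obtain as where as: "good as" and min: "\<And>as'. good as' \<Longrightarrow> length as \<le> length as'"
    using ex_has_least_nat[of good _ length] by metis
  from as obtain bs where bs: "ys = as @ bs" "as \<noteq> []" "bs \<noteq> []"
    "\<And>a b. a \<in> set as \<Longrightarrow> b \<in> set bs \<Longrightarrow> R a b"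
    unfolding good_def by blast
  have nosplit: "\<not> (\<forall>u\<in>set us. \<forall>v\<in>set vs. R u v)" if "as = us @ vs" "us \<noteq> []" "vs \<noteq> []" for us vs
  proof
    assume "\<forall>u\<in>set us. \<forall>v\<in>set vs. R u v"
    with that bs have "good us" unfolding good_def by (intro exI[of _ "vs @ bs"]) auto
    from min[OF this] that show False by simp
  qed
  \<comment> \<open>If \<open>x\<close> is above all of \<open>as\<close>, it joins the second
    block; if it is below all of \<open>ys\<close>, it is split off along the converse. Otherwise
    some entry of \<open>as\<close> is above \<open>x\<close> and some entry of \<open>ys\<close> is
    below it.\<close>
  consider (above) "\<forall>a\<in>set as. R a x" | (below) "\<forall>y\<in>set ys. R x y"
    | (inside) a0 where "a0 \<in> set as" "R x a0" "\<not> (\<forall>y\<in>set ys. R x y)"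
    using total dist bs(1) by (metis UnI1 distinct_append set_append disjoint_iff list.set_intros(1))
  thus ?thesis
  proof cases
    case above
    with bs have "splits R (ys @ [x])"
      unfolding splits_def by (intro exI[of _ as] exI[of _ "bs @ [x]"]) auto
    thus ?thesis ..
  next
    case below
    with bs have "splits R\<inverse>\<inverse> (ys @ [x])"
      unfolding splits_def by (intro exI[of _ ys] exI[of _ "[x]"]) auto
    thus ?thesis ..
  next
    case inside
    obtain y0 where y0: "y0 \<in> set ys" "R y0 x"
      using inside(3) total dist by (metis distinct_append disjoint_iff list.set_intros(1))
    \<comment> \<open>Entries of \<open>bs\<close> lie above \<open>a0\<close>, which lies above
      \<open>x\<close>, so an entry below \<open>x\<close> can only be in \<open>as\<close>.\<close>
    have y0as: "y0 \<in> set as"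
    proof (rule ccontr)
      assume "y0 \<notin> set as"
      hence "R a0 y0" using y0 bs inside by auto
      with inside(2) have "R x y0" by (rule trans)
      with y0 asym show False by blast
    qed
    have "subseq (as @ [x]) (ys @ [x])"
      using bs(1) by (auto intro: list_emb_append_mono)
    moreover have "length (as @ [x]) \<le> length ys" "2 \<le> length (as @ [x])"
      using bs by (auto simp: Suc_le_eq)
    ultimately have "splits R (as @ [x]) \<or> splits R\<inverse>\<inverse> (as @ [x])" by (rule IH)
    then obtain cs ds where cd: "as @ [x] = cs @ ds" "cs \<noteq> []" "ds \<noteq> []"
      and cdR: "(\<forall>a\<in>set cs. \<forall>b\<in>set ds. R a b) \<or> (\<forall>a\<in>set cs. \<forall>b\<in>set ds. R b a)"
      unfolding splits_def by auto
    obtain ds' where ds: "ds = ds' @ [x]" "as = cs @ ds'"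
      using cd by (cases ds rule: rev_cases) auto
    \<comment> \<open>Otherwise \<open>x\<close> would be above all of \<open>as\<close> or below
      all of it, but \<open>y0\<close> and \<open>a0\<close> lie on opposite sides.\<close>
    have "ds' \<noteq> []"
    proof
      assume "ds' = []"
      with ds have "as = cs" "ds = [x]" by simp_all
      with cdR y0as y0(2) inside(1,2) show False using asym by fastforce
    qed
    \<comment> \<open>A split of \<open>as @ [x]\<close> along \<open>R\<close> would restrict to a
      split of \<open>as\<close> into \<open>cs\<close> and \<open>ds'\<close>, against the
      minimality of \<open>as\<close>.\<close>
    hence desc: "\<forall>a\<in>set cs. \<forall>b\<in>set ds. R b a"
      using nosplit[of cs ds'] ds cd(2) cdR by fastforce
    hence "y0 \<notin> set cs" using asym[OF y0(2)] ds(1) by auto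
    hence "y0 \<in> set ds'" using y0as ds(2) by simp
    obtain a where a: "a \<in> set cs" using cd by (cases cs) auto
    obtain b where b: "b \<in> set bs" using bs by (cases bs) auto
    \<comment> \<open>In the order given by \<open>R\<close> the values increase as
      \<open>y0\<close>, \<open>x\<close>, \<open>a\<close>, \<open>b\<close>: pattern 3142 for
      \<open><\<close> and 2413 for \<open>>\<close>.\<close>
    have "subseq ([a] @ [y0] @ [b] @ [x]) (cs @ ds' @ bs @ [x])"
      using a b \<open>y0 \<in> set ds'\<close> by (intro list_emb_append_mono) (auto simp: subseq_singleton_left)
    hence "subseq [a, y0, b, x] (ys @ [x])" using bs(1) ds by simp
    from avoid[OF this] y0 a b desc ds bs show ?thesis by auto
  qed
qed

text \<open>Induction on length over all separable lists is required, since
  \<open>splits_snoc\<close> needs the claim for \<open>as @ [x]\<close>, a subsequence that need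
  not be a prefix. Of the two patterns, 3142 serves the case where the prefix is a direct sum and
  2413 the skew case.\<close>

lemma separable_splits:
  assumes "separable xs" "distinct xs" "2 \<le> length xs"
  shows "splits (<) xs \<or> splits (>) xs"
  using assms
proof (induction "length xs" arbitrary: xs rule: less_induct)
  case less
  have conv: "(<)\<inverse>\<inverse> = ((>) :: nat \<Rightarrow> nat \<Rightarrow> bool)" "(>)\<inverse>\<inverse> = ((<) :: nat \<Rightarrow> nat \<Rightarrow> bool)"
    by (auto simp: fun_eq_iff)
  obtain ys x where xs: "xs = ys @ [x]" using less.prems(3) by (cases xs rule: rev_cases) auto
  have IH: "splits (<) zs \<or> splits (>) zs"
    if "subseq zs (ys @ [x])" "length zs \<le> length ys" "2 \<le> length zs" for zs
  proof (rule less.hyps)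
    show "length zs < length xs" "2 \<le> length zs" using that xs by simp_all
    show "separable zs" using separable_subseq[OF less.prems(1)] that xs by simp
    show "distinct zs" using less.prems(2) that xs by (metis distinct_nthsI subseq_conv_nths)
  qed
  show ?case
  proof (cases "length ys = 1")
    case True
    then obtain y where "ys = [y]" by (auto simp: length_Suc_conv)
    with xs less.prems(2) have "xs = [y] @ [x]" "y < x \<or> x < y" by auto
    thus ?thesis unfolding splits_def
      by (metis empty_iff empty_set not_Cons_self2 set_ConsD)
  next
    case False
    hence "splits (<) ys \<or> splits (>) ys"
      using xs less.prems(3) by (intro IH) auto
    thus ?thesis
    proof
      assume "splits (<) ys"
      hence "splits (<) (ys @ [x]) \<or> splits (<)\<inverse>\<inverse> (ys @ [x])"
      proof (rule splits_snoc[rotated -1])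
        fix p q r t assume "subseq [p, q, r, t] (ys @ [x])"
        with less.prems(1) show "\<not> (q < t \<and> t < p \<and> p < r)"
          unfolding separable_iff xs by blast
      next
        fix zs assume "subseq zs (ys @ [x])" "length zs \<le> length ys" "2 \<le> length zs"
        from IH[OF this] show "splits (<) zs \<or> splits (<)\<inverse>\<inverse> zs"
          unfolding conv by blast
      qed (use less.prems(2) xs in auto)
      thus ?thesis unfolding xs conv by blast
    next
      assume "splits (>) ys"
      hence "splits (>) (ys @ [x]) \<or> splits (>)\<inverse>\<inverse> (ys @ [x])"
      proof (rule splits_snoc[rotated -1])
        fix p q r t assume "subseq [p, q, r, t] (ys @ [x])"
        with less.prems(1) show "\<not> (q > t \<and> t > p \<and> p > r)"
          unfolding separable_iff xs by blast
      next
        fix zs assume "subseq zs (ys @ [x])" "length zs \<le> length ys" "2 \<le> length zs"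
        from IH[OF this] show "splits (>) zs \<or> splits (>)\<inverse>\<inverse> zs"
          unfolding conv by blast
      qed (use less.prems(2) xs in auto)
      thus ?thesis unfolding xs conv by blast
    qed
  qed
qed

section \<open>Counting bonds instead of bonded positions\<close>

text \<open>Counting adjacent pairs rather than positions makes the count additive under
  concatenation, up to one term at the junction.\<close>

fun bonds :: "nat list \<Rightarrow> nat" where
  "bonds (x # y # xs) = (if x = Suc y \<or> y = Suc x then 1 else 0) + bonds (y # xs)"
| "bonds _ = 0"

lemma bonds_append:
  "bonds (xs @ ys) = bonds xs + bonds ys +
     (if xs \<noteq> [] \<and> ys \<noteq> [] \<and> (last xs = Suc (hd ys) \<or> hd ys = Suc (last xs)) then 1 else 0)"
proof (induction xs rule: bonds.induct)
  case ("2_2" v)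
  show ?case by (cases ys) auto
qed auto

lemma bonds_rev [simp]: "bonds (rev xs) = bonds xs"
proof (induction xs)
  case (Cons x xs)
  show ?case
    using Cons bonds_append[of "[x]" xs] by (auto simp: bonds_append last_rev)
qed simp

lemma bonds_eq_card: "bonds s = card {i. Suc i < length s \<and> (s ! i = Suc (s ! Suc i) \<or> s ! Suc i = Suc (s ! i))}"
proof (induction s rule: bonds.induct)
  case (1 x y xs)
  let ?A = "\<lambda>s. {i. Suc i < length s \<and> (s ! i = Suc (s ! Suc i) \<or> s ! Suc i = Suc (s ! i))}"
  have "?A (x # y # xs) = (if x = Suc y \<or> y = Suc x then {0} else {}) \<union> Suc ` ?A (y # xs)"
    (is "?L = ?R")
  proof (rule set_eqI)
    fix i show "i \<in> ?L \<longleftrightarrow> i \<in> ?R" by (cases i) auto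
  qed
  moreover have "finite (?A (y # xs))" by (rule finite_subset[of _ "{..length (y # xs)}"]) auto
  ultimately show ?case
    using 1 by (simp add: card_image card_insert_if image_iff)
qed auto

text \<open>If \<open>B\<close> is the set of left ends of bonds, the bonded positions are
  \<open>B\<close> together with its shift by one. Two left ends \<open>i < j\<close> already give
  three positions \<open>i\<close>, \<open>Suc i\<close>, \<open>Suc j\<close>.\<close>

lemma card_bonded_positions_eq_2_iff: "card (bonded_positions s) = 2 \<longleftrightarrow> bonds s = 1"
proof -
  define B where "B = {i. Suc i < length s \<and> (s ! i = Suc (s ! Suc i) \<or> s ! Suc i = Suc (s ! i))}"
  have bonded: "bonded_positions s = B \<union> Suc ` B"
  proof (rule set_eqI)
    fix i show "i \<in> bonded_positions s \<longleftrightarrow> i \<in> B \<union> Suc ` B"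
      by (cases i) (auto simp: bonded_positions_def B_def)
  qed
  have fin: "finite B" unfolding B_def by (rule finite_subset[of _ "{..length s}"]) auto
  have "card (B \<union> Suc ` B) = 2 \<longleftrightarrow> card B = 1"
  proof
    assume "card B = 1"
    then obtain i where "B = {i}" by (auto simp: card_1_singleton_iff)
    thus "card (B \<union> Suc ` B) = 2" by simp
  next
    assume two: "card (B \<union> Suc ` B) = 2"
    hence "B \<noteq> {}" by auto
    define i j where "i = Min B" and "j = Max B"
    have ij: "i \<in> B" "j \<in> B" "\<And>k. k \<in> B \<Longrightarrow> i \<le> k \<and> k \<le> j"
      using fin \<open>B \<noteq> {}\<close> by (auto simp: i_def j_def)
    have "i = j"
    proof (rule ccontr)
      assume "i \<noteq> j"
      with ij have "i < j" by fastforce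
      hence "card {i, Suc i, Suc j} = 3" by simp
      moreover have "card {i, Suc i, Suc j} \<le> card (B \<union> Suc ` B)"
        using ij fin by (intro card_mono) auto
      ultimately show False using two by simp
    qed
    with ij have "B = {i}" by fastforce
    thus "card B = 1" by simp
  qed
  thus ?thesis unfolding bonded bonds_eq_card B_def .
qed

section \<open>Existence of a bond\<close>

text \<open>A value not exceeding the maximum of \<open>xs\<close> cannot lie in \<open>ys\<close>,
  so \<open>xs\<close> fills an initial segment. Thus the summands of a direct sum are again
  permutations of intervals, with a shifted base.\<close>

lemma interval_split:
  assumes "set xs \<union> set ys = {a..<a + n}" "distinct (xs @ ys)"
    and less: "\<forall>x\<in>set xs. \<forall>y\<in>set ys. x < y"
  shows "set xs = {a..<a + length xs}" "set ys = {a + length xs..<a + n}"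
proof -
  have len: "length xs + length ys = n"
    using assms(1,2) distinct_card[of "xs @ ys"] by simp
  have "set xs = {a..<a + length xs}"
  proof (cases "set xs = {}")
    case False
    define m where "m = Max (set xs)"
    have m: "m \<in> set xs" "\<And>x. x \<in> set xs \<Longrightarrow> x \<le> m" using False by (auto simp: m_def)
    have "set xs = {a..<Suc m}"
    proof (rule set_eqI)
      fix x
      have "x \<in> set xs" if "a \<le> x" "x \<le> m"
      proof -
        have "x \<in> set xs \<union> set ys" using that m(1) unfolding assms(1) by (metis UnI1 assms(1) atLeastLessThan_iff order_le_less_trans)
        with less m(1) that show ?thesis by fastforce
      qed
      thus "x \<in> set xs \<longleftrightarrow> x \<in> {a..<Suc m}" using m assms(1) by fastforce
    qed
    moreover from this have "length xs = Suc m - a"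
      using assms(2) distinct_card[of xs] by simp
    moreover have "a \<le> m" using m(1) assms(1) by auto
    ultimately show ?thesis by simp
  qed simp
  moreover have "set ys = {a..<a + n} - set xs" using assms(1,2) by auto
  ultimately show "set xs = {a..<a + length xs}" "set ys = {a + length xs..<a + n}" using len by auto
qed

text \<open>A summand of length at least two has a bond by induction; two summands of length one
  hold consecutive values and bond with each other. The arbitrary base \<open>a\<close> accommodates
  the upper summand.\<close>

lemma bonds_pos:
  assumes "separable xs" "distinct xs" "set xs = {a..<a + n}" "2 \<le> length xs"
  shows "0 < bonds xs"
  using assms
proof (induction "length xs" arbitrary: xs a n rule: less_induct)
  case less
  \<comment> \<open>Stated for any \<open>zs\<close> as long as \<open>xs\<close>, so that it covers
    \<open>xs\<close> when that is a direct sum and \<open>rev xs\<close> when \<open>xs\<close> is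
    a skew sum.\<close>
  have *: "0 < bonds zs"
    if "zs = us @ vs" "us \<noteq> []" "vs \<noteq> []" "\<forall>u\<in>set us. \<forall>v\<in>set vs. u < v"
      "length zs = length xs" "separable zs" "distinct zs" "set zs = {a..<a + n}" for zs us vs
  proof -
    have us: "set us = {a..<a + length us}" and vs: "set vs = {a + length us..<a + n}"
      using interval_split[of us vs a n] that by auto
    have n: "n = length us + length vs"
      using that distinct_card[of zs] by simp
    have len: "length us < length xs" "length vs < length xs"
      using that(1,2,3) that(5) by (cases us; cases vs; simp)+
    have sep: "separable us" "separable vs"
      using separable_subseq[OF that(6), of us] separable_subseq[OF that(6), of vs] that(1) by auto
    show ?thesis
    proof (cases "length us = 1 \<and> length vs = 1")
      case True
      then obtain u v where "us = [u]" "vs = [v]" by (auto simp: length_Suc_conv)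
      with us vs n that(1) show ?thesis by auto
    next
      case False
      hence "2 \<le> length us \<or> 2 \<le> length vs" using that(2,3)
        by (cases us; cases vs) (auto simp: Suc_le_eq)
      hence "0 < bonds us \<or> 0 < bonds vs"
        using less.hyps[OF len(1) sep(1) _ us] less.hyps[OF len(2) sep(2), of "a + length us" "length vs"]
          vs n that(1,7) by (auto simp: add.assoc)
      thus ?thesis using that(1) by (auto simp: bonds_append)
    qed
  qed
  from separable_splits[OF less.prems(1,2,4)] show ?case
  proof
    assume "splits (<) xs"
    then obtain us vs where "xs = us @ vs" "us \<noteq> []" "vs \<noteq> []" "\<forall>u\<in>set us. \<forall>v\<in>set vs. u < v"
      unfolding splits_def by blast
    from *[OF this] less.prems show ?thesis by simp
  next
    assume "splits (>) xs"
    then obtain us vs where "xs = us @ vs" "us \<noteq> []" "vs \<noteq> []" "\<forall>u\<in>set us. \<forall>v\<in>set vs. u > v"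
      unfolding splits_def by blast
    with *[of "rev xs" "rev vs" "rev us"] less.prems show ?thesis
      by (simp flip: rev_append add: Un_commute Int_commute)
  qed
qed

section \<open>Permutations with exactly one bond, by the order of their end entries\<close>

definition one_bond :: "nat \<Rightarrow> nat \<Rightarrow> nat list set" where
  "one_bond a n = {xs \<in> permutations_of_set {a..<a + n}. separable xs \<and> bonds xs = 1}"

definition ascending :: "nat \<Rightarrow> nat \<Rightarrow> nat list set" where
  "ascending a n = {xs \<in> one_bond a n. hd xs < last xs}"

definition descending :: "nat \<Rightarrow> nat \<Rightarrow> nat list set" where
  "descending a n = {xs \<in> one_bond a n. last xs < hd xs}"

lemma one_bondD:
  assumes "xs \<in> one_bond a n"
  shows "separable xs" "bonds xs = 1" "distinct xs" "set xs = {a..<a + n}" "length xs = n" "2 \<le> n"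
proof -
  show *: "separable xs" "bonds xs = 1" "distinct xs" "set xs = {a..<a + n}"
    using assms by (auto simp: one_bond_def permutations_of_set_def)
  show len: "length xs = n"
    using distinct_card[OF *(3)] *(4) by simp
  show "2 \<le> n"
    using *(2) len by (cases xs rule: bonds.cases) auto
qed

lemma one_bondI:
  assumes "separable xs" "bonds xs = 1" "distinct xs" "set xs = {a..<a + n}"
  shows "xs \<in> one_bond a n"
  using assms by (auto simp: one_bond_def permutations_of_set_def)

lemma finite_one_bond [simp]: "finite (one_bond a n)"
  by (simp add: one_bond_def)

lemma finite_ascending [simp]: "finite (ascending a n)"
  and finite_descending [simp]: "finite (descending a n)"
  by (simp_all add: ascending_def descending_def)

lemma descending_eq: "descending a n = rev ` ascending a n"
proof -
  have rev: "rev xs \<in> one_bond a n \<longleftrightarrow> xs \<in> one_bond a n" for xs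
    by (simp add: one_bond_def permutations_of_set_def)
  have ne: "xs \<noteq> []" if "xs \<in> one_bond a n" for xs
    using that by (auto simp: one_bond_def)
  show ?thesis
  proof (intro equalityI subsetI)
    fix xs assume "xs \<in> descending a n"
    hence "rev xs \<in> ascending a n"
      using rev ne by (auto simp: ascending_def descending_def hd_rev last_rev)
    thus "xs \<in> rev ` ascending a n" by (metis image_eqI rev_rev_ident)
  next
    fix xs assume "xs \<in> rev ` ascending a n"
    thus "xs \<in> descending a n"
      using rev ne by (auto simp: ascending_def descending_def hd_rev last_rev)
  qed
qed

lemma card_descending: "card (descending a n) = card (ascending a n)"
  by (simp add: descending_eq card_image)

lemma one_bond_eq: "one_bond a n = ascending a n \<union> descending a n"
proof -
  have "hd xs \<noteq> last xs" if "xs \<in> one_bond a n" for xs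
  proof -
    from one_bondD[OF that] obtain x y ys where "xs = x # y # ys"
      by (cases xs rule: bonds.cases) auto
    with one_bondD(3)[OF that] show ?thesis by (auto split: if_splits)
  qed
  thus ?thesis by (auto simp: ascending_def descending_def nat_neq_iff)
qed

lemma card_one_bond: "card (one_bond a n) = 2 * card (ascending a n)"
proof -
  have "ascending a n \<inter> descending a n = {}" by (auto simp: ascending_def descending_def)
  thus ?thesis by (simp add: one_bond_eq card_Un_disjoint card_descending)
qed

text \<open>The end entries rule out a skew sum, so the list is a direct sum. Two summands of length
  at least two would give two bonds by \<open>bonds_pos\<close>, so one summand is a single entry:
  the minimum in front or the maximum at the end.\<close>

lemma ascending_extreme:
  assumes "xs \<in> ascending a n"
  shows "hd xs = a \<or> last xs = a + n - 1"
proof -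
  have ob: "xs \<in> one_bond a n" and less: "hd xs < last xs"
    using assms by (auto simp: ascending_def)
  note xs = one_bondD[OF ob]
  have "\<not> splits (>) xs" using splits_hd_last[of "(>)" xs] less by auto
  with separable_splits[of xs] xs have "splits (<) xs" by auto
  then obtain us vs where uv: "xs = us @ vs" "us \<noteq> []" "vs \<noteq> []"
    and lt: "\<forall>u\<in>set us. \<forall>v\<in>set vs. u < v"
    unfolding splits_def by blast
  have us: "set us = {a..<a + length us}" and vs: "set vs = {a + length us..<a + n}"
    using interval_split[of us vs a n] uv xs lt by auto
  have n: "n = length us + length vs" using xs(5) uv(1) by simp
  have sep: "separable us" "separable vs"
    using separable_subseq[OF xs(1), of us] separable_subseq[OF xs(1), of vs] uv(1) by auto
  have "\<not> (2 \<le> length us \<and> 2 \<le> length vs)"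
  proof
    assume "2 \<le> length us \<and> 2 \<le> length vs"
    hence "0 < bonds us" "0 < bonds vs"
      using bonds_pos[OF sep(1) _ us] bonds_pos[OF sep(2), of "a + length us" "length vs"]
        vs n xs(3) uv(1) by (auto simp: add.assoc)
    thus False using xs(2) uv(1) by (simp add: bonds_append)
  qed
  hence "length us = 1 \<or> length vs = 1" using uv(2,3)
    by (cases us; cases vs) (auto simp: Suc_le_eq)
  thus ?thesis
  proof
    assume "length us = 1"
    then obtain u where "us = [u]" by (auto simp: length_Suc_conv)
    thus ?thesis using us uv(1) by auto
  next
    assume "length vs = 1"
    then obtain v where "vs = [v]" by (auto simp: length_Suc_conv)
    thus ?thesis using vs uv(1) n by auto
  qed
qed

section \<open>Removing and adding an extreme end entry\<close>

text \<open>Since \<open>ys\<close> has length at least two, it has a bond of its own. This is the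
  only one, so the junction with \<open>a\<close> is not a bond.\<close>

lemma one_bond_Cons:
  assumes "a # ys \<in> one_bond a n" "3 \<le> n"
  shows "ys \<in> one_bond (Suc a) (n - 1)" "hd ys \<noteq> Suc a"
proof -
  note xs = one_bondD[OF assms(1)]
  have sep: "separable ys" using separable_subseq[OF xs(1)] by auto
  have "set ys = set (a # ys) - {a}" using xs(3) by auto
  also have "\<dots> = {Suc a..<Suc a + (n - 1)}" unfolding xs(4) using assms(2) by auto
  finally have set: "set ys = {Suc a..<Suc a + (n - 1)}" .
  have "0 < bonds ys" using bonds_pos[OF sep _ set] xs(3,5) assms(2) by auto
  moreover have "ys \<noteq> []" using xs(5) assms(2) by auto
  ultimately have "bonds ys = 1" "hd ys \<noteq> Suc a"
    using xs(2) bonds_append[of "[a]" ys] by (auto split: if_splits)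
  with sep set xs(3) show "ys \<in> one_bond (Suc a) (n - 1)" "hd ys \<noteq> Suc a"
    by (auto intro: one_bondI)
qed

lemma one_bond_snoc:
  assumes "ys @ [a + n - 1] \<in> one_bond a n" "3 \<le> n"
  shows "ys \<in> one_bond a (n - 1)" "last ys \<noteq> a + n - 2"
proof -
  note xs = one_bondD[OF assms(1)]
  have sep: "separable ys" using separable_subseq[OF xs(1)] by auto
  have "set ys = set (ys @ [a + n - 1]) - {a + n - 1}" using xs(3) by auto
  also have "\<dots> = {a..<a + (n - 1)}" unfolding xs(4) using assms(2) by auto
  finally have set: "set ys = {a..<a + (n - 1)}" .
  have "0 < bonds ys" using bonds_pos[OF sep _ set] xs(3,5) assms(2) by auto
  moreover have "ys \<noteq> []" using xs(5) assms(2) by auto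
  moreover from this have
    "bonds ys + (if last ys = Suc (a + n - 1) \<or> a + n - 1 = Suc (last ys) then 1 else 0) = 1"
    using xs(2) by (simp add: bonds_append)
  ultimately have "bonds ys = 1" and "a + n - 1 \<noteq> Suc (last ys)"
    by (simp_all split: if_splits)
  with assms(2) show "last ys \<noteq> a + n - 2" by linarith
  from sep \<open>bonds ys = 1\<close> _ set show "ys \<in> one_bond a (n - 1)"
    by (rule one_bondI) (use xs(3) in simp)
qed

lemma ascending_Cons:
  assumes "ys \<in> one_bond (Suc a) (n - 1)" "hd ys \<noteq> Suc a"
  shows "a # ys \<in> ascending a n"
proof -
  note ys = one_bondD[OF assms(1)]
  have "ys \<noteq> []" using ys(5,6) by auto
  hence "last ys \<in> set ys" by simp
  hence "a < last ys" unfolding ys(4) by auto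
  have ne: "a \<noteq> Suc (hd ys)" using \<open>ys \<noteq> []\<close> hd_in_set[of ys] ys(4) by auto
  have "separable (a # ys)" using ys(1,4) by (intro separable_Cons) auto
  moreover have "bonds (a # ys) = 1"
    using bonds_append[of "[a]" ys] ys(2) assms(2) ne by simp
  moreover have "distinct (a # ys)" "set (a # ys) = {a..<a + n}"
    using ys(3,4,6) by auto
  ultimately have "a # ys \<in> one_bond a n" by (rule one_bondI)
  thus ?thesis using \<open>ys \<noteq> []\<close> \<open>a < last ys\<close> by (simp add: ascending_def)
qed

lemma ascending_snoc:
  assumes "ys \<in> one_bond a (n - 1)" "last ys \<noteq> a + n - 2"
  shows "ys @ [a + n - 1] \<in> ascending a n"
proof -
  note ys = one_bondD[OF assms(1)]
  have "ys \<noteq> []" using ys(5,6) by auto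
  have hd: "hd ys \<in> set ys" and last: "last ys \<in> set ys" using \<open>ys \<noteq> []\<close> by simp_all
  have "separable (ys @ [a + n - 1])" using ys(1,4) by (intro separable_snoc) auto
  moreover have "bonds (ys @ [a + n - 1]) = 1"
    using ys(2,6) assms(2) last unfolding ys(4) by (auto simp: bonds_append)
  moreover have "distinct (ys @ [a + n - 1])" "set (ys @ [a + n - 1]) = {a..<a + n}"
    using ys(3,4,6) by auto
  ultimately have "ys @ [a + n - 1] \<in> one_bond a n" by (rule one_bondI)
  thus ?thesis using \<open>ys \<noteq> []\<close> hd unfolding ys(4) by (auto simp: ascending_def)
qed

lemma descending_hd_last:
  assumes "ys \<in> descending a n"
  shows "ys \<in> one_bond a n" "a < hd ys" "last ys < a + n - 1" "hd ys < a + n" "ys \<noteq> []"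
proof -
  show ob: "ys \<in> one_bond a n" using assms by (simp add: descending_def)
  note ys = one_bondD[OF ob]
  show "ys \<noteq> []" using ys(5,6) by auto
  hence "hd ys \<in> set ys" "last ys \<in> set ys" by simp_all
  thus "a < hd ys" "last ys < a + n - 1" "hd ys < a + n"
    using assms unfolding ys(4) by (auto simp: descending_def)
qed

section \<open>The recurrence\<close>

text \<open>Remove an extreme end entry. What remains has one bond, and its end entry at the
  junction is not extreme there, since that would make a second bond. If the remainder is ascending,
  \<open>ascending_extreme\<close> thus puts an extreme entry at its other end; removing that one
  too leaves a descending list.\<close>

lemma ascending_eq:
  assumes "3 \<le> n"
  shows "ascending a n =
    (\<lambda>ys. a # ys) ` descending (Suc a) (n - 1) \<union>
    (\<lambda>ys. ys @ [a + n - 1]) ` descending a (n - 1) \<union>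
    (\<lambda>ys. a # ys @ [a + n - 1]) ` descending (Suc a) (n - 2)"
    (is "_ = ?A \<union> ?B \<union> ?C")
proof (intro equalityI subsetI)
  fix xs assume asc: "xs \<in> ascending a n"
  hence ob: "xs \<in> one_bond a n" by (simp add: ascending_def)
  note xs = one_bondD[OF ob]
  have "xs \<noteq> []" using xs(5) assms by auto
  have hd_case: "xs \<in> ?A \<union> ?C" if "hd xs = a"
  proof -
    from that \<open>xs \<noteq> []\<close> obtain ys where ys: "xs = a # ys" by (cases xs) auto
    note C = one_bond_Cons[OF ob[unfolded ys] assms]
    show ?thesis
    proof (cases "ys \<in> descending (Suc a) (n - 1)")
      case True
      thus ?thesis using ys by auto
    next
      case False
      hence "ys \<in> ascending (Suc a) (n - 1)" using C(1) one_bond_eq by auto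
      from ascending_extreme[OF this] C(2) assms have last: "last ys = Suc a + (n - 1) - 1" by simp
      have "ys \<noteq> []" using xs(5) assms ys by auto
      with last obtain zs where zs: "ys = zs @ [Suc a + (n - 1) - 1]"
        by (metis append_butlast_last_id)
      \<comment> \<open>\<open>one_bond_snoc\<close> needs length at least three for
        \<open>ys\<close>. For \<open>n = 3\<close> the single entry of \<open>zs\<close> could only
        be \<open>Suc a\<close>, which would bond with \<open>a\<close>.\<close>
      have "n \<noteq> 3"
      proof
        assume "n = 3"
        then obtain z where z: "zs = [z]" using zs ys xs(5) by (auto simp: length_Suc_conv)
        have "z \<in> {Suc a..<Suc a + (n - 1)}"
          unfolding one_bondD(4)[OF C(1), symmetric] using zs z by simp
        moreover have "z \<noteq> Suc a" "z \<noteq> Suc (Suc a)"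
          using C(2) zs z one_bondD(3)[OF C(1)] \<open>n = 3\<close> by simp_all
        ultimately show False using \<open>n = 3\<close> by simp
      qed
      hence n: "3 \<le> n - 1" using assms by simp
      note D = one_bond_snoc[OF C(1)[unfolded zs] n]
      have "zs \<noteq> []" using one_bondD(5,6)[OF D(1)] by auto
      \<comment> \<open>Neither end entry of \<open>zs\<close> is extreme, so
        \<open>ascending_extreme\<close> leaves only the descending case.\<close>
      hence "hd zs \<noteq> Suc a" using C(2) zs by simp
      with ascending_extreme[of zs "Suc a" "n - 1 - 1"] D(2) n
      have "zs \<notin> ascending (Suc a) (n - 1 - 1)" by auto
      with D(1) one_bond_eq have "zs \<in> descending (Suc a) (n - 2)"
        by (simp add: numeral_2_eq_2)
      moreover have "xs = a # zs @ [a + n - 1]" using ys zs assms by simp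
      ultimately show ?thesis by blast
    qed
  qed
  show "xs \<in> ?A \<union> ?B \<union> ?C"
  proof (cases "hd xs = a")
    case True
    with hd_case show ?thesis by blast
  next
    case False
    with ascending_extreme[OF asc] have "last xs = a + n - 1" by simp
    with \<open>xs \<noteq> []\<close> obtain ys where ys: "xs = ys @ [a + n - 1]"
      by (metis append_butlast_last_id)
    note D = one_bond_snoc[OF ob[unfolded ys] assms]
    have "ys \<noteq> []" using one_bondD(5,6)[OF D(1)] by auto
    hence "hd ys \<noteq> a" using False ys by simp
    moreover have "a + (n - 1) - 1 = a + n - 2" using assms by simp
    ultimately have "ys \<notin> ascending a (n - 1)"
      using ascending_extreme[of ys a "n - 1"] D(2) by metis
    with D(1) one_bond_eq have "ys \<in> descending a (n - 1)" by simp
    thus ?thesis using ys by blast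
  qed
next
  fix xs assume "xs \<in> ?A \<union> ?B \<union> ?C"
  then consider ys where "xs = a # ys" "ys \<in> descending (Suc a) (n - 1)"
    | ys where "xs = ys @ [a + n - 1]" "ys \<in> descending a (n - 1)"
    | ys where "xs = a # ys @ [a + n - 1]" "ys \<in> descending (Suc a) (n - 2)"
    by blast
  thus "xs \<in> ascending a n"
  proof cases
    case 1
    with descending_hd_last[OF 1(2)] show ?thesis by (auto intro: ascending_Cons)
  next
    case 2
    have "last ys \<noteq> a + n - 2" using descending_hd_last(3)[OF 2(2)] assms by simp
    with descending_hd_last(1)[OF 2(2)] 2(1) show ?thesis by (metis ascending_snoc)
  next
    case 3
    note ys = descending_hd_last[OF 3(2)]
    have "ys @ [Suc a + (n - 1) - 1] \<in> ascending (Suc a) (n - 1)"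
    proof (rule ascending_snoc)
      show "ys \<in> one_bond (Suc a) (n - 1 - 1)" using ys(1) by (simp add: numeral_2_eq_2)
      show "last ys \<noteq> Suc a + (n - 1) - 2" using ys(3) assms by simp
    qed
    hence "ys @ [a + n - 1] \<in> one_bond (Suc a) (n - 1)"
      using assms by (simp add: ascending_def)
    from ascending_Cons[OF this] ys show ?thesis using 3(1) by simp
  qed
qed

lemma card_ascending_rec:
  assumes "3 \<le> n"
  shows "card (ascending a n) =
    card (ascending (Suc a) (n - 1)) + card (ascending a (n - 1)) + card (ascending (Suc a) (n - 2))"
proof -
  let ?A = "(\<lambda>ys. a # ys) ` descending (Suc a) (n - 1)"
  let ?B = "(\<lambda>ys. ys @ [a + n - 1]) ` descending a (n - 1)"
  let ?C = "(\<lambda>ys. a # ys @ [a + n - 1]) ` descending (Suc a) (n - 2)"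
  \<comment> \<open>The three images are told apart by whether the minimum comes first and the
    maximum last: a descending list neither starts with its minimum nor ends with its
    maximum.\<close>
  have "hd xs = a \<and> last xs \<noteq> a + n - 1" if "xs \<in> ?A" for xs
    using that assms descending_hd_last(3,5)[of _ "Suc a" "n - 1"] by fastforce
  moreover have "hd xs \<noteq> a" if "xs \<in> ?B" for xs
    using that descending_hd_last(2,5)[of _ a "n - 1"] by fastforce
  moreover have "hd xs = a \<and> last xs = a + n - 1" if "xs \<in> ?C" for xs
    using that by auto
  ultimately have "?A \<inter> ?B = {}" "(?A \<union> ?B) \<inter> ?C = {}"
    by blast+
  hence "card (ascending a n) = card ?A + card ?B + card ?C"
    unfolding ascending_eq[OF assms] by (simp add: card_Un_disjoint)
  thus ?thesis by (simp add: card_image inj_on_def card_descending)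
qed

lemma ascending_2: "ascending a 2 = {[a, Suc a]}"
proof (intro equalityI subsetI)
  fix xs assume asc: "xs \<in> ascending a 2"
  hence ob: "xs \<in> one_bond a 2" by (simp add: ascending_def)
  note xs = one_bondD[OF ob]
  from xs(5) obtain x y where "xs = [x, y]" by (auto simp: numeral_2_eq_2 length_Suc_conv)
  moreover have "{a..<a + 2} = {a, Suc a}" by auto
  ultimately show "xs \<in> {[a, Suc a]}"
    using asc xs(4) by (auto simp: ascending_def doubleton_eq_iff)
next
  fix xs assume "xs \<in> {[a, Suc a]}"
  moreover have "separable [a, Suc a]"
    by (intro separable_Cons) (auto simp: separable_iff)
  ultimately show "xs \<in> ascending a 2"
    by (auto simp: ascending_def intro!: one_bondI)
qed

lemma ascending_empty: "n < 2 \<Longrightarrow> ascending a n = {}"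
  using one_bondD(6) by (fastforce simp: ascending_def)

text \<open>The recurrence and the initial values do not depend on the base, so translation
  invariance follows by induction without an explicit bijection.\<close>

lemma card_ascending_shift: "card (ascending a n) = card (ascending b n)"
proof (induction n arbitrary: a b rule: less_induct)
  case (less n)
  consider "n < 2" | "n = 2" | "3 \<le> n" by linarith
  thus ?case
  proof cases
    case 3
    with less.IH[of "n - 1" "Suc a" "Suc b"] less.IH[of "n - 1" a b] less.IH[of "n - 2" "Suc a" "Suc b"]
    show ?thesis by (simp add: card_ascending_rec)
  qed (simp_all add: ascending_empty ascending_2)
qed

text \<open>The factor 2 is the reversal symmetry between ascending and descending lists.\<close>

lemma c_eq: "c n = 2 * card (ascending 1 n)"
proof -
  have "{1..n} = {1..<1 + n}" by auto
  thus ?thesis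
    unfolding c_def card_bonded_positions_eq_2_iff using card_one_bond[of 1 n]
    by (simp add: one_bond_def)
qed

section \<open>Initial values, recurrence and generating function\<close>

theorem theorem9:
  shows "c 0 = 0 \<and> c 1 = 0 \<and> c 2 = 2 \<and>
    (\<forall>n\<ge>3. c n = 2 * c (n - 1) + c (n - 2)) \<and>
    (Abs_fps (\<lambda>n. of_nat (c n)) :: rat fps)
      = (2 * fps_X ^ 2) / (1 - 2 * fps_X - fps_X ^ 2)"
proof -
  have init: "c 0 = 0" "c 1 = 0" "c 2 = 2"
    by (simp_all add: c_eq ascending_empty ascending_2)
  have rec: "c n = 2 * c (n - 1) + c (n - 2)" if "3 \<le> n" for n
    using card_ascending_rec[OF that, of 1] card_ascending_shift[of "Suc 1" _ 1]
    by (simp add: c_eq)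
  let ?F = "Abs_fps (\<lambda>n. of_nat (c n)) :: rat fps"
  let ?D = "1 - 2 * fps_X - fps_X ^ 2 :: rat fps"
  \<comment> \<open>Coefficients are compared after clearing the denominator. From index 3 on they
    vanish by the recurrence; at index 2 the value \<open>c 2 = 2\<close> survives and gives the
    numerator.\<close>
  have "?F * ?D = 2 * fps_X ^ 2"
  proof (rule fps_ext)
    fix n
    have D: "?F * ?D = ?F - fps_const 2 * (?F * fps_X) - ?F * fps_X ^ 2"
      by (simp add: algebra_simps numeral_fps_const)
    have coeff: "fps_nth (?F * ?D) n =
        of_nat (c n) - 2 * (if n = 0 then 0 else of_nat (c (n - 1))) -
        (if n < 2 then 0 else of_nat (c (n - 2)))"
      unfolding D by (simp add: fps_X_power_mult_right_nth)
    have rhs: "fps_nth (2 * fps_X ^ 2 :: rat fps) n = (if n = 2 then 2 else 0)"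
      by (simp add: numeral_fps_const)
    consider "n = 0" | "n = 1" | "n = 2" | "3 \<le> n" by linarith
    thus "fps_nth (?F * ?D) n = fps_nth (2 * fps_X ^ 2) n"
    proof cases
      case 4
      with rec[OF 4] show ?thesis unfolding coeff rhs by simp
    qed (unfold coeff rhs, insert init, simp_all)
  qed
  moreover have "?D \<noteq> 0"
  proof
    assume "?D = 0"
    hence "fps_nth ?D 0 = 0" by simp
    thus False by simp
  qed
  ultimately have "?F = (2 * fps_X ^ 2) / ?D"
    by (metis nonzero_mult_div_cancel_right)
  with init rec show ?thesis by blast
qed

end
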